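(* Let $\widetilde p_1(t,\rho)$, $\widetilde p_2(t,\rho)$ and $\Sigma_\rho\in S_T$ be the quantities and permutation associated to the prices. Let $\omega_1=\sigma_{i_1}\cdots\sigma_{i_k}$ and $\omega_2=\sigma_{j_1}\cdots\sigma_{j_m}$ be the formal words of the partitions of $\mathbb R^2_+$ by straight lines corresponding to parameters $\rho_1,\rho_2\in[-1,0)\cup(0,+\infty)$, respectively. If $\omega_1$ and $\omega_2$, considered as permutations, are equal to $\Sigma_\rho$, then they can be transformed one into another by a finite number of moves of the following two types (applied to consecutive letters of a word): (a) $\sigma_{a}\sigma_{b}\leftrightarrow\sigma_{b}\sigma_{a}$ if $|a-b|\ge2$; (b) $\sigma_a\sigma_{a+1}\sigma_a\leftrightarrow\sigma_{a+1}\sigma_a\sigma_{a+1}$ ($1\le a\le T-2$).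
   Context: Given are prices $p_0(t)>0$, $p(t)=(p_1(t),p_2(t))>0$, $t=1,\dots,T$. Put $\widehat p_i(t)=p_i(t)/p_0(t)$, $i=1,2$. For $\rho\in[-1,0)$ put $\widetilde p_i(t,\rho)=\widehat p_i(t)^{-\rho}$. For $\rho\in(0,+\infty)$ put $\widetilde p_i(t,\rho)=\tfrac1\varepsilon-\widehat p_i(t)^{-\rho}$, where $\varepsilon>0$ is fixed so small that $\widehat p_1(t)^{-\rho}<\tfrac1\varepsilon$, $\widehat p_2(t)^{-\rho}<\tfrac1\varepsilon$ for all $t$, and $\bigl(\widehat p_1(t)^{-\rho}x_1^{-\rho}+\widehat p_2(t)^{-\rho}x_2^{-\rho}\bigr)^{-1/\rho}>1$ for all $t$ whenever $x_1^{-\rho}+x_2^{-\rho}\le\varepsilon$. Numbering and $\Sigma_\rho$: the indices are numbered so that $\widetilde p_1(1,\rho)<\widetilde p_1(2,\rho)<\dots<\widetilde p_1(T,\rho)$, and $\Sigma_\rho=(\Sigma_\rho(1),\dots,\Sigma_\rho(T))\in S_T$ is the permutation with $\widetilde p_2(\Sigma_\rho(1),\rho)<\dots<\widetilde p_2(\Sigma_\rho(T),\rho)$, for some fixed $\rho\in[-1,0)\cup(0,+\infty)$ (all these values are assumed distinct; the inequalities do not change with $\rho$). Partition and word for a given $\rho$: consider the partition of $\mathbb R^2_+$ by the lines $\widetilde p_1(t,\rho)z_1+\widetilde p_2(t,\rho)z_2=1$, $t=1,\dots,T$. For $\alpha\in(0,\tfrac\pi2)$ let $R_\alpha=\{(z_1,z_2)\in\mathbb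 R^2_+\mid z_2=z_1\tan\alpha\}$. Standing assumptions: no three of the lines have a common point, and each $R_\alpha$ meets at most one intersection point of the lines. Let $0=\alpha_0<\alpha_1<\dots<\alpha_N<\alpha_{N+1}=\tfrac\pi2$, where $\alpha_1,\dots,\alpha_N$ are all $\alpha\in(0,\tfrac\pi2)$ for which $R_\alpha$ meets an intersection point of the lines. For $\alpha\in(0,\tfrac\pi2)\setminus\{\alpha_1,\dots,\alpha_N\}$ let $\pi(\alpha)=(\pi_1(\alpha),\dots,\pi_T(\alpha))\in S_T$ be the order in which the lines are met along $R_\alpha$ as $z_1$ decreases from $+\infty$ to $0$ (so if $R_\alpha$ meets the $t$-th line at first coordinate $z_1(t)$, then $z_1(\pi_T(\alpha))<\dots<z_1(\pi_1(\alpha))$). When $\alpha$ crosses $\alpha_i$, $\pi(\alpha)$ changes by exchanging the entries in two adjacent positions $t_i,t_i+1$; this is denoted by the elementary transposition $\sigma_{t_i}=(t_i,t_i+1)$. The formal word of the partition is $\omega=\sigma_{t_1}\cdots\sigma_{t_N}$ (the empty word if $N=0$). A word considered as a permutation is the permutation obtained from the identity $(1,\dots,T)$ by successively performing these exchanges of adjacent positions, from left to right. *)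

theory Defs
  imports Complex_Main "HOL-Combinatorics.Permutations"
begin

text \<open>Prices are functions of the period \<open>t \<in> {1..T}\<close>; elements of \<open>S\<^sub>T\<close> are
  functions \<open>\<pi> :: nat \<Rightarrow> nat\<close> with \<open>\<pi> permutes {1..T}\<close>, to be read as the row
  \<open>(\<pi> 1, \<dots>, \<pi> T)\<close>.\<close>

definition phat :: "(nat \<Rightarrow> real) \<Rightarrow> (nat \<Rightarrow> real) \<Rightarrow> nat \<Rightarrow> real" where
  "phat p0 p t = p t / p0 t"

definition rho_range :: "real set" where
  "rho_range = {-1..<0} \<union> {0<..}"

text \<open>The constant \<open>\<epsilon>\<close> used for \<open>\<rho> > 0\<close>. The variables \<open>x1\<close>, \<open>x2\<close> range over positive reals:
  for \<open>\<rho> > 0\<close> the power \<open>x powr (-\<rho>)\<close> is infinite at \<open>0\<close> in the mathematics, whereas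
  \<open>0 powr (-\<rho>) = 0\<close> in HOL.\<close>

definition admissible_eps ::
  "nat \<Rightarrow> (nat \<Rightarrow> real) \<Rightarrow> (nat \<Rightarrow> real) \<Rightarrow> (nat \<Rightarrow> real) \<Rightarrow> real \<Rightarrow> real \<Rightarrow> bool" where
  "admissible_eps T p0 p1 p2 \<rho> \<epsilon> \<longleftrightarrow>
     0 < \<epsilon> \<and>
     (\<forall>t\<in>{1..T}. phat p0 p1 t powr (-\<rho>) < 1 / \<epsilon> \<and> phat p0 p2 t powr (-\<rho>) < 1 / \<epsilon>) \<and>
     (\<forall>t\<in>{1..T}. \<forall>x1>0. \<forall>x2>0. x1 powr (-\<rho>) + x2 powr (-\<rho>) \<le> \<epsilon> \<longrightarrow>
        (phat p0 p1 t powr (-\<rho>) * x1 powr (-\<rho>)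
          + phat p0 p2 t powr (-\<rho>) * x2 powr (-\<rho>)) powr (-1 / \<rho>) > 1)"

text \<open>Since \<open>\<epsilon>\<close> is fixed separately for every \<open>\<rho> > 0\<close>, it is a function of \<open>\<rho>\<close>.\<close>

definition ptilde ::
  "(real \<Rightarrow> real) \<Rightarrow> (nat \<Rightarrow> real) \<Rightarrow> (nat \<Rightarrow> real) \<Rightarrow> real \<Rightarrow> nat \<Rightarrow> real" where
  "ptilde \<epsilon> p0 p \<rho> t =
     (if \<rho> < 0 then phat p0 p t powr (-\<rho>) else 1 / \<epsilon> \<rho> - phat p0 p t powr (-\<rho>))"

definition sorting_perm :: "nat \<Rightarrow> (nat \<Rightarrow> real) \<Rightarrow> nat \<Rightarrow> nat" where
  "sorting_perm T b =
     (THE \<pi>. \<pi> permutes {1..T} \<and> strict_mono_on {1..T} (\<lambda>i. b (\<pi> i)))"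

text \<open>In the following \<open>a t\<close> and \<open>b t\<close> are the coefficients of the \<open>t\<close>-th line.\<close>

definition line :: "(nat \<Rightarrow> real) \<Rightarrow> (nat \<Rightarrow> real) \<Rightarrow> nat \<Rightarrow> (real \<times> real) set" where
  "line a b t = {(z1, z2). a t * z1 + b t * z2 = 1}"

definition ray :: "real \<Rightarrow> (real \<times> real) set" where
  "ray \<alpha> = {(z1, z2). 0 \<le> z1 \<and> 0 \<le> z2 \<and> z2 = z1 * tan \<alpha>}"

definition intersection_points ::
  "nat \<Rightarrow> (nat \<Rightarrow> real) \<Rightarrow> (nat \<Rightarrow> real) \<Rightarrow> (real \<times> real) set" where
  "intersection_points T a b =
     {z. \<exists>s\<in>{1..T}. \<exists>t\<in>{1..T}. s \<noteq> t \<and> z \<in> line a b s \<and> z \<in> line a b t}"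

definition generic_lines :: "nat \<Rightarrow> (nat \<Rightarrow> real) \<Rightarrow> (nat \<Rightarrow> real) \<Rightarrow> bool" where
  "generic_lines T a b \<longleftrightarrow>
     (\<forall>r\<in>{1..T}. \<forall>s\<in>{1..T}. \<forall>t\<in>{1..T}. r \<noteq> s \<and> s \<noteq> t \<and> r \<noteq> t \<longrightarrow>
        line a b r \<inter> line a b s \<inter> line a b t = {}) \<and>
     (\<forall>\<alpha>\<in>{0<..<pi/2}. \<forall>z \<in> ray \<alpha> \<inter> intersection_points T a b.
        \<forall>w \<in> ray \<alpha> \<inter> intersection_points T a b. z = w)"

definition crossing_angles :: "nat \<Rightarrow> (nat \<Rightarrow> real) \<Rightarrow> (nat \<Rightarrow> real) \<Rightarrow> real set" where
  "crossing_angles T a b = {\<alpha>\<in>{0<..<pi/2}. ray \<alpha> \<inter> intersection_points T a b \<noteq> {}}"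

definition meet_coord :: "(nat \<Rightarrow> real) \<Rightarrow> (nat \<Rightarrow> real) \<Rightarrow> real \<Rightarrow> nat \<Rightarrow> real" where
  "meet_coord a b \<alpha> t = fst (THE z. z \<in> ray \<alpha> \<inter> line a b t)"

definition line_order ::
  "nat \<Rightarrow> (nat \<Rightarrow> real) \<Rightarrow> (nat \<Rightarrow> real) \<Rightarrow> real \<Rightarrow> nat \<Rightarrow> nat" where
  "line_order T a b \<alpha> =
     (THE \<pi>. \<pi> permutes {1..T} \<and>
        (\<forall>i\<in>{1..T}. \<forall>j\<in>{1..T}. i < j \<longrightarrow>
           meet_coord a b \<alpha> (\<pi> j) < meet_coord a b \<alpha> (\<pi> i)))"

text \<open>A word is the list of the indices of its letters. Composing a permutation on the right with
  \<open>transpose k (Suc k)\<close> exchanges its entries in the positions \<open>k\<close> and \<open>k + 1\<close>.\<close>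

definition exchange :: "nat \<Rightarrow> (nat \<Rightarrow> nat) \<Rightarrow> nat \<Rightarrow> nat" where
  "exchange k \<pi> = \<pi> \<circ> Transposition.transpose k (Suc k)"

definition word_perm :: "nat list \<Rightarrow> nat \<Rightarrow> nat" where
  "word_perm w = foldl (\<lambda>\<pi> k. exchange k \<pi>) id w"

text \<open>The list \<open>\<alpha>s\<close> below is \<open>\<alpha>\<^sub>0 = 0, \<alpha>\<^sub>1, \<dots>, \<alpha>\<^sub>N, \<alpha>\<^sub>N\<^sub>+\<^sub>1 = \<pi>/2\<close>, so the letter with
  list index \<open>i\<close> belongs to the crossing of \<open>\<alpha>s ! Suc i\<close>.\<close>

definition formal_word ::
  "nat \<Rightarrow> (nat \<Rightarrow> real) \<Rightarrow> (nat \<Rightarrow> real) \<Rightarrow> nat list" where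
  "formal_word T a b =
     (let \<alpha>s = 0 # sorted_list_of_set (crossing_angles T a b) @ [pi/2]
      in map (\<lambda>i. THE k. k \<in> {1..<T} \<and>
                (\<forall>\<alpha>\<in>{\<alpha>s ! i<..<\<alpha>s ! (i + 1)}. \<forall>\<beta>\<in>{\<alpha>s ! (i + 1)<..<\<alpha>s ! (i + 2)}.
                   line_order T a b \<beta> = exchange k (line_order T a b \<alpha>)))
           [0..<card (crossing_angles T a b)])"

inductive move :: "nat \<Rightarrow> nat list \<Rightarrow> nat list \<Rightarrow> bool" for T where
  far: "\<lbrakk>a \<in> {1..<T}; b \<in> {1..<T}; \<bar>int a - int b\<bar> \<ge> 2\<rbrakk>
    \<Longrightarrow> move T (u @ [a, b] @ v) (u @ [b, a] @ v)"
| braid: "\<lbrakk>1 \<le> a; a + 2 \<le> T\<rbrakk>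
    \<Longrightarrow> move T (u @ [a, a + 1, a] @ v) (u @ [a + 1, a, a + 1] @ v)"

text \<open>Moves may be applied in both directions, hence the equivalence closure.\<close>

definition transformable :: "nat \<Rightarrow> nat list \<Rightarrow> nat list \<Rightarrow> bool" where
  "transformable T = equivclp (move T)"

end

theory Submission
  imports Defs
begin

text \<open>Two lines whose coefficients satisfy \<open>a s < a t\<close> meet in the open quadrant only if
  \<open>b t < b s\<close>, and then under a single angle. So a formal word has at most as many letters as
  \<open>\<Sigma>\<^sub>\<rho>\<close> has inversions; as a word for \<open>\<Sigma>\<^sub>\<rho>\<close> it is therefore reduced. Any two reduced words of one
  permutation are related by the moves (Matsumoto's theorem, proved by induction on the length:
  the last letters are descents of the permutation, and two different descents are reconciled by a
  common prefix followed by the two sides of a move). The letters automatically lie in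
  \<open>{1..<T}\<close>, because a permutation of \<open>{1..T}\<close> has no other descents.\<close>

text \<open>Pairs of positions, taken over all naturals so that no bound \<open>T\<close> enters;
  for a permutation of \<open>{1..T}\<close> the set is still finite.\<close>

definition inversions :: "(nat \<Rightarrow> nat) \<Rightarrow> (nat \<times> nat) set" where
  "inversions \<pi> = {(i, j). i < j \<and> \<pi> j < \<pi> i}"

abbreviation descent :: "(nat \<Rightarrow> nat) \<Rightarrow> nat \<Rightarrow> bool" where
  "descent \<pi> k \<equiv> \<pi> (Suc k) < \<pi> k"

text \<open>The equality case of the length bound \<open>card_inversions_word_perm\<close>.\<close>

definition reduced :: "nat list \<Rightarrow> bool" where
  "reduced w \<longleftrightarrow> card (inversions (word_perm w)) = length w"

section \<open>Inversions and exchanges\<close>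

lemma inversions_id [simp]: "inversions id = {}" "inversions (\<lambda>i. i) = {}"
  by (auto simp: inversions_def)

lemma exchange_exchange [simp]: "exchange k (exchange k \<pi>) = \<pi>"
  by (simp add: exchange_def comp_assoc)

lemma exchange_apply:
  "exchange k \<pi> i = (if i = k then \<pi> (Suc k) else if i = Suc k then \<pi> k else \<pi> i)"
  by (auto simp: exchange_def transpose_def)

lemma exchange_commute:
  assumes "\<bar>int a - int b\<bar> \<ge> 2"
  shows "exchange a (exchange b \<pi>) = exchange b (exchange a \<pi>)"
  using assms by (auto simp: exchange_apply fun_eq_iff)

lemma exchange_braid:
  "exchange a (exchange (Suc a) (exchange a \<pi>))
    = exchange (Suc a) (exchange a (exchange (Suc a) \<pi>))"
  by (auto simp: exchange_apply fun_eq_iff)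

text \<open>Swapping k and k+1 keeps the relative order of any two positions other than this pair
  itself, so renaming the positions carries the remaining inversions over.\<close>

lemma inversions_exchange:
  "inversions (exchange k \<pi>) - {(k, Suc k)}
    = map_prod (transpose k (Suc k)) (transpose k (Suc k)) ` (inversions \<pi> - {(k, Suc k)})"
    (is "?L (exchange k \<pi>) = ?s ` ?L \<pi>")
proof -
  have sub: "?s ` ?L \<pi> \<subseteq> ?L (exchange k \<pi>)" for \<pi>
    by (auto simp: inversions_def exchange_apply transpose_def split: if_splits)
  \<comment> \<open>\<open>?s\<close> is an involution, so \<open>sub\<close> applied to
    \<open>exchange k \<pi>\<close> yields the reverse inclusion.\<close>
  have "?L (exchange k \<pi>) = ?s ` ?s ` ?L (exchange k \<pi>)"
    by (simp add: image_image prod.map_comp prod.map_id0)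
  also have "\<dots> \<subseteq> ?s ` ?L \<pi>"
    using sub[of "exchange k \<pi>"] by (intro image_mono) simp
  finally show ?thesis
    using sub[of \<pi>] by blast
qed

lemma card_inversions_exchange:
  "card (inversions (exchange k \<pi>) - {(k, Suc k)}) = card (inversions \<pi> - {(k, Suc k)})"
  unfolding inversions_exchange
  by (intro card_image inj_on_subset[OF prod.inj_map]) simp_all

lemma finite_inversions_exchange:
  assumes "finite (inversions \<pi>)"
  shows "finite (inversions (exchange k \<pi>))"
proof -
  have "finite (inversions (exchange k \<pi>) - {(k, Suc k)})"
    unfolding inversions_exchange using assms by simp
  then show ?thesis by simp
qed

text \<open>The pair (k, k+1) is the one inversion that the exchange removes; all others correspond
  bijectively.\<close>

lemma card_inversions_descent:
  assumes "finite (inversions \<pi>)" "descent \<pi> k"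
  shows "card (inversions \<pi>) = Suc (card (inversions (exchange k \<pi>)))"
proof -
  have "(k, Suc k) \<in> inversions \<pi>" "(k, Suc k) \<notin> inversions (exchange k \<pi>)"
    using assms(2) by (auto simp: inversions_def exchange_apply)
  then show ?thesis
    by (metis card.remove[OF assms(1)] card_inversions_exchange Diff_empty Diff_insert0)
qed

text \<open>Positions outside \<open>{1..T}\<close> are fixed and values at positions inside stay
  inside, so the position 0 and those beyond \<open>T\<close> are in order with all others.\<close>

lemma inversions_permutes:
  fixes T :: nat
  assumes "\<pi> permutes {1..T}"
  shows "inversions \<pi> \<subseteq> {1..T} \<times> {1..T}" "finite (inversions \<pi>)"
proof -
  have out: "\<pi> i = i" if "i \<notin> {1..T}" for i
    using assms that by (rule permutes_not_in)
  have range: "\<pi> i \<in> {1..T}" if "i \<in> {1..T}" for i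
    using permutes_in_image[OF assms] that by blast
  show sub: "inversions \<pi> \<subseteq> {1..T} \<times> {1..T}"
  proof clarify
    fix i j assume "(i, j) \<in> inversions \<pi>"
    then have ij: "i < j" "\<pi> j < \<pi> i" by (auto simp: inversions_def)
    show "i \<in> {1..T} \<and> j \<in> {1..T}"
      using ij out[of i] out[of j] range[of i] range[of j]
      by (cases "i \<in> {1..T}"; cases "j \<in> {1..T}") auto
  qed
  then show "finite (inversions \<pi>)"
    by (rule finite_subset) simp
qed

lemma exchange_permutes:
  assumes "\<pi> permutes {1..T}" "descent \<pi> k"
  shows "k \<in> {1..<T}" "exchange k \<pi> permutes {1..T}"
proof -
  have "(k, Suc k) \<in> inversions \<pi>"
    using assms(2) by (simp add: inversions_def)
  then show k: "k \<in> {1..<T}"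
    using inversions_permutes(1)[OF assms(1)] by auto
  then show "exchange k \<pi> permutes {1..T}"
    unfolding exchange_def
    by (intro permutes_compose[OF _ assms(1)] permutes_swap_id) auto
qed

text \<open>By injectivity the absence of descents means strict growth, hence i \<le>
  \<open>\<pi> i\<close> everywhere, and only the identity among the permutations of
  \<open>{1..T}\<close> satisfies this.\<close>

lemma permutes_no_descent:
  fixes T :: nat
  assumes "\<pi> permutes {1..T}" "\<And>k. \<not> descent \<pi> k"
  shows "\<pi> = id"
proof -
  have "strict_mono \<pi>"
    unfolding strict_mono_Suc_iff
  proof
    fix k
    have "\<pi> k \<noteq> \<pi> (Suc k)"
      using permutes_inj[OF assms(1)] by (simp add: inj_eq)
    then show "\<pi> k < \<pi> (Suc k)"
      using assms(2)[of k] by simp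
  qed
  then show ?thesis
    by (intro permutes_natset_ge[OF assms(1)]) (simp add: strict_mono_imp_increasing)
qed

section \<open>Reduced words\<close>

lemma word_perm_Nil [simp]: "word_perm [] = id"
  by (simp add: word_perm_def)

lemma word_perm_snoc [simp]: "word_perm (w @ [k]) = exchange k (word_perm w)"
  by (simp add: word_perm_def)

text \<open>Each letter changes the status of a single pair, up to renaming, and so adds at most one
  inversion.\<close>

lemma card_inversions_word_perm:
  "finite (inversions (word_perm w)) \<and> card (inversions (word_perm w)) \<le> length w"
proof (induction w rule: rev_induct)
  case Nil
  then show ?case by simp
next
  case (snoc k w)
  let ?P = "inversions (word_perm w)" and ?Q = "inversions (exchange k (word_perm w))"
  have "card ?Q \<le> Suc (card (?Q - {(k, Suc k)}))"
    using diff_card_le_card_Diff[of "{(k, Suc k)}" ?Q] by simp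
  also have "\<dots> = Suc (card (?P - {(k, Suc k)}))"
    by (simp only: card_inversions_exchange)
  also have "\<dots> \<le> Suc (card ?P)"
    using snoc by (simp add: card_mono)
  finally show ?case
    using snoc finite_inversions_exchange by simp
qed

text \<open>A last letter that leaves no descent at \<open>k\<close> creates no inversion, so the
  count could not exceed \<open>length w\<close>. Undoing a descent costs exactly one inversion,
  which keeps the prefix reduced.\<close>

lemma reduced_snocD:
  assumes "reduced (w @ [k])"
  shows "reduced w" "descent (word_perm (w @ [k])) k"
proof -
  let ?P = "word_perm w" and ?Q = "word_perm (w @ [k])"
  have fin: "finite (inversions ?P)" "finite (inversions ?Q)"
    and le: "card (inversions ?P) \<le> length w"
    using card_inversions_word_perm by blast+
  have card: "card (inversions ?Q) = Suc (length w)"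
    using assms by (simp add: reduced_def)
  show desc: "descent ?Q k"
  proof (rule ccontr)
    assume "\<not> descent ?Q k"
    then have "(k, Suc k) \<notin> inversions ?Q"
      by (simp add: inversions_def)
    then have "card (inversions ?Q) = card (inversions ?P - {(k, Suc k)})"
      using card_inversions_exchange[of k ?P] by simp
    also have "\<dots> \<le> card (inversions ?P)"
      using fin by (simp add: card_mono)
    finally show False
      using card le by simp
  qed
  show "reduced w"
    using card_inversions_descent[OF fin(2) desc] card by (simp add: reduced_def)
qed

lemma reduced_snocI:
  assumes "reduced w" "descent (exchange k (word_perm w)) k"
  shows "reduced (w @ [k])"
  using card_inversions_descent[of "word_perm (w @ [k])" k] card_inversions_word_perm[of "w @ [k]"]
    assms by (simp add: reduced_def)

text \<open>Undo descents one at a time; the number of inversions drops until the identity is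
  reached, and the undone letters, read backwards, form the word.\<close>

lemma reduced_word_exists:
  fixes T :: nat
  assumes "\<pi> permutes {1..T}"
  obtains w where "reduced w" "word_perm w = \<pi>"
proof -
  have "\<exists>w. reduced w \<and> word_perm w = \<pi>"
    using assms
  proof (induction "card (inversions \<pi>)" arbitrary: \<pi> rule: less_induct)
    case less
    show ?case
    proof (cases "\<exists>k. descent \<pi> k")
      case True
      then obtain k where k: "descent \<pi> k" by blast
      obtain w where "reduced w" "word_perm w = exchange k \<pi>"
        using less.hyps exchange_permutes(2)[OF less.prems k]
          card_inversions_descent[OF inversions_permutes(2)[OF less.prems] k]
        by (metis lessI)
      then have "reduced (w @ [k]) \<and> word_perm (w @ [k]) = \<pi>"
        using k by (simp add: reduced_snocI)
      then show ?thesis by blast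
    next
      case False
      then have "\<pi> = id"
        using permutes_no_descent[OF less.prems] by blast
      then show ?thesis
        by (intro exI[of _ "[]"]) (simp add: reduced_def)
    qed
  qed
  then show ?thesis
    using that by blast
qed

section \<open>Matsumoto's theorem\<close>

lemma transformable_refl [simp]: "transformable T w w"
  by (simp add: transformable_def)

lemma transformable_sym: "transformable T v w \<Longrightarrow> transformable T w v"
  by (simp add: transformable_def equivclp_sym)

lemma transformable_trans [trans]:
  "transformable T u v \<Longrightarrow> transformable T v w \<Longrightarrow> transformable T u w"
  unfolding transformable_def by (rule equivclp_trans)

lemma move_append: "move T u v \<Longrightarrow> move T (u @ x) (v @ x)"
proof (induction rule: move.induct)
  case (far a b u v)
  then show ?case using move.far[of a T b u "v @ x"] by simp
next
  case (braid a u v)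
  then show ?case using move.braid[of a T u "v @ x"] by simp
qed

lemma transformable_append:
  "transformable T u v \<Longrightarrow> transformable T (u @ x) (v @ x)"
  unfolding transformable_def
proof (induction rule: equivclp_induct)
  case base
  then show ?case by simp
next
  case (step v w)
  then have "equivclp (move T) (v @ x) (w @ x)"
    by (meson move_append r_into_equivclp equivclp_sym)
  with step.IH show ?case
    by (rule equivclp_trans)
qed

lemma transformable_far:
  assumes "a \<in> {1..<T}" "b \<in> {1..<T}" "\<bar>int a - int b\<bar> \<ge> 2"
  shows "transformable T (u @ [a, b]) (u @ [b, a])"
  using move.far[OF assms, of u "[]"] by (simp add: transformable_def r_into_equivclp)

lemma transformable_braid:
  assumes "a \<in> {1..<T}" "Suc a \<in> {1..<T}"
  shows "transformable T (u @ [a, Suc a, a]) (u @ [Suc a, a, Suc a])"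
  using move.braid[of a T u "[]"] assms by (simp add: transformable_def r_into_equivclp)

text \<open>The bound \<open>{1..T}\<close> on the permutation puts the last letters, being
  descents, into the range required by the moves, and it lets \<open>reduced_word_exists\<close>
  supply the common prefixes.\<close>

theorem reduced_words_transformable:
  assumes "reduced w" "reduced w'" "word_perm w = word_perm w'" "word_perm w permutes {1..T}"
  shows "transformable T w w'"
  using assms
proof (induction "length w" arbitrary: w w')
  case 0
  then have w: "w = []" by simp
  have "length w' = card (inversions (word_perm w))"
    using 0(3,4) by (simp add: reduced_def)
  then have "length w' = 0"
    by (simp add: w)
  then show ?case by (simp add: w)
next
  case (Suc n)
  \<comment> \<open>The order of the last letters is fixed here; the opposite order is reduced to
    this one at the end by symmetry.\<close>
  have main: "transformable T (u @ [a]) (v @ [b])"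
    if red: "reduced (u @ [a])" "reduced (v @ [b])"
      and eq: "word_perm (u @ [a]) = word_perm (v @ [b])"
      and perm: "word_perm (u @ [a]) permutes {1..T}"
      and len: "length u = n" and ab: "a \<le> b" for u v a b
  proof -
    define \<pi> where "\<pi> = word_perm (u @ [a])"
    have \<pi>: "\<pi> permutes {1..T}" and \<pi>_b: "\<pi> = word_perm (v @ [b])"
      using perm eq by (simp_all add: \<pi>_def)
    have da: "descent \<pi> a" and db: "descent \<pi> b"
      using reduced_snocD(2)[OF red(1)] reduced_snocD(2)[OF red(2)] eq by (simp_all add: \<pi>_def)
    have u: "reduced u" "word_perm u = exchange a \<pi>"
      using reduced_snocD(1)[OF red(1)] by (simp_all add: \<pi>_def)
    have v: "reduced v" "word_perm v = exchange b \<pi>"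
      using reduced_snocD(1)[OF red(2)] by (simp_all add: \<pi>_b)
    have lenv: "length v = n"
      using red eq len by (simp add: reduced_def)
    note pa = exchange_permutes[OF \<pi> da] and pb = exchange_permutes[OF \<pi> db]
    \<comment> \<open>Induction hypothesis in usable form: the prefix \<open>u\<close> may be
      replaced by any reduced word of the same permutation, and likewise \<open>v\<close> in
      \<open>right\<close>.\<close>
    have left: "transformable T (u @ [a]) (x @ [a])"
      if "reduced x" "word_perm x = exchange a \<pi>" for x
      using Suc.hyps(1)[of u x] that u pa(2) len by (simp add: transformable_append)
    have right: "transformable T (x @ [b]) (v @ [b])"
      if "reduced x" "word_perm x = exchange b \<pi>" for x
      using Suc.hyps(1)[of v x] that v pb(2) lenv
      by (simp add: transformable_append transformable_sym)
    consider "a = b" | "b = Suc a" | "\<bar>int a - int b\<bar> \<ge> 2"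
      using ab by linarith
    then show ?thesis
    proof cases
      case 1
      then show ?thesis
        using left[OF v(1)] v(2) by simp
    next
      case 2
      note b = \<open>b = Suc a\<close>
      \<comment> \<open>Here the entries at a, a+1, a+2 decrease. Three exchanges reverse them, each
        undoing a descent; \<open>x\<close> is a reduced word for what remains, and appending three
        letters to it recovers \<open>\<pi>\<close>.\<close>
      have d1: "descent (exchange a \<pi>) (Suc a)"
        using da db by (simp add: exchange_apply b)
      have d2: "descent (exchange (Suc a) (exchange a \<pi>)) a"
        using db by (simp add: exchange_apply b)
      obtain x where x: "reduced x"
          "word_perm x = exchange a (exchange (Suc a) (exchange a \<pi>))"
        using exchange_permutes(2)[OF exchange_permutes(2)[OF pa(2) d1] d2]
        by (rule reduced_word_exists)
      \<comment> \<open>Starting from the other descent reverses the same three entries, so one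
        prefix \<open>x\<close> serves both sides of the braid move.\<close>
      have x': "word_perm x = exchange (Suc a) (exchange a (exchange (Suc a) \<pi>))"
        using x(2) by (simp only: exchange_braid)
      have "reduced (x @ [a])"
        using reduced_snocI[OF x(1), of a] x(2) d2 by simp
      then have "reduced (x @ [a, Suc a])"
        using reduced_snocI[of "x @ [a]" "Suc a"] x(2) d1 by simp
      moreover have "word_perm ((x @ [a]) @ [Suc a]) = exchange a \<pi>"
        by (simp only: word_perm_snoc exchange_exchange x(2))
      ultimately have "transformable T (u @ [a]) (x @ [a, Suc a, a])"
        using left[of "x @ [a, Suc a]"] by simp
      also have "transformable T \<dots> (x @ [Suc a, a, Suc a])"
        using pa(1) pb(1) b by (intro transformable_braid) simp_all
      also have "transformable T \<dots> (v @ [b])"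
      proof -
        have "reduced (x @ [Suc a])"
          using reduced_snocI[OF x(1), of "Suc a"] x' da by (simp add: exchange_apply)
        then have "reduced (x @ [Suc a, a])"
          using reduced_snocI[of "x @ [Suc a]" a] x' da db by (simp add: exchange_apply b)
        moreover have "word_perm ((x @ [Suc a]) @ [a]) = exchange (Suc a) \<pi>"
          by (simp only: word_perm_snoc exchange_exchange x')
        ultimately show ?thesis
          using right[of "x @ [Suc a, a]"] by (simp add: b)
      qed
      finally show ?thesis .
    next
      case 3
      \<comment> \<open>The exchanges act on disjoint pairs of positions, so each descent survives
        the other exchange and both can be undone in either order.\<close>
      have da': "descent (exchange b \<pi>) a" and db': "descent (exchange a \<pi>) b"
        using 3 da db by (auto simp: exchange_apply)
      obtain x where x: "reduced x" "word_perm x = exchange b (exchange a \<pi>)"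
        using exchange_permutes(2)[OF pa(2) db'] by (rule reduced_word_exists)
      have x': "word_perm x = exchange a (exchange b \<pi>)"
        using x(2) exchange_commute[OF 3] by simp
      have "transformable T (u @ [a]) ((x @ [b]) @ [a])"
        using x db' by (intro left reduced_snocI) simp_all
      also have "transformable T \<dots> ((x @ [a]) @ [b])"
        using transformable_sym[OF transformable_far[OF pa(1) pb(1) 3, of x]] by simp
      also have "transformable T \<dots> (v @ [b])"
        using x(1) x' da' by (intro right reduced_snocI) simp_all
      finally show ?thesis .
    qed
  qed
  have len: "length w' = Suc n"
    using Suc.hyps(2) Suc.prems by (simp add: reduced_def)
  obtain u a where w: "w = u @ [a]"
    using Suc.hyps(2) by (metis length_Suc_conv_rev)
  obtain v b where w': "w' = v @ [b]"
    using len by (metis length_Suc_conv_rev)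
  show ?case
  proof (cases "a \<le> b")
    case True
    moreover have "length u = n"
      using Suc.hyps(2) by (simp add: w)
    ultimately show ?thesis
      using Suc.prems unfolding w w' by (intro main)
  next
    case False
    then have "b \<le> a"
      by simp
    moreover have "length v = n"
      using len by (simp add: w')
    moreover have "word_perm w' permutes {1..T}"
      using Suc.prems(3,4) by metis
    ultimately have "transformable T w' w"
      using Suc.prems(1,2) Suc.prems(3)[symmetric] unfolding w w' by (intro main)
    then show ?thesis
      by (rule transformable_sym)
  qed
qed

section \<open>Counting the crossings\<close>

text \<open>The link from geometry to words: a bound on the number of crossing angles bounds the
  word length.\<close>

lemma length_formal_word: "length (formal_word T a b) = card (crossing_angles T a b)"
  by (simp add: formal_word_def Let_def)

text \<open>With the lines numbered by increasing \<open>a\<close>, these are the pairs whose two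
  coefficients are ordered oppositely; \<open>s < t\<close> stands for
  \<open>a s < a t\<close>.\<close>

definition crossing_pairs :: "nat \<Rightarrow> (nat \<Rightarrow> real) \<Rightarrow> (nat \<times> nat) set" where
  "crossing_pairs T b = {(s, t). s \<in> {1..T} \<and> t \<in> {1..T} \<and> s < t \<and> b t < b s}"

lemma card_crossing_angles_le:
  assumes "strict_mono_on {1..T} a"
  shows "card (crossing_angles T a b) \<le> card (crossing_pairs T b)"
proof -
  \<comment> \<open>Subtracting the two line equations at a common point (z1, z1 tan \<alpha>) and
    cancelling z1 determines tan \<alpha>; this is its arctangent.\<close>
  define angle where "angle = (\<lambda>(s, t). arctan ((a t - a s) / (b s - b t)))"
  have "finite (crossing_pairs T b)"
    by (rule finite_subset[of _ "{1..T} \<times> {1..T}"]) (auto simp: crossing_pairs_def)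
  moreover have "crossing_angles T a b \<subseteq> angle ` crossing_pairs T b"
  proof
    fix \<alpha> assume "\<alpha> \<in> crossing_angles T a b"
    then obtain z where \<alpha>: "0 < \<alpha>" "\<alpha> < pi / 2"
      and mem: "z \<in> ray \<alpha>" "z \<in> intersection_points T a b"
      by (auto simp: crossing_angles_def)
    obtain z1 z2 where z12: "z = (z1, z2)"
      by fastforce
    have z: "0 \<le> z1" "z2 = z1 * tan \<alpha>"
      using mem(1) by (simp_all add: ray_def z12)
    obtain s' t' where st': "s' \<in> {1..T}" "t' \<in> {1..T}" "s' \<noteq> t'"
        "a s' * z1 + b s' * z2 = 1" "a t' * z1 + b t' * z2 = 1"
      using mem(2) by (auto simp: intersection_points_def line_def z12)
    obtain s t where st: "s \<in> {1..T}" "t \<in> {1..T}" "s < t"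
        "a s * z1 + b s * z2 = 1" "a t * z1 + b t * z2 = 1"
      using st' by (metis nat_neq_iff)
    \<comment> \<open>For z1 = 0 the point on the ray would be the origin, which lies on no
      line.\<close>
    have z1: "z1 > 0"
      using z st(4) by (cases "z1 = 0") auto
    have tan: "tan \<alpha> > 0"
      using \<alpha> by (rule tan_gt_zero)
    have less: "a s < a t"
      using strict_mono_onD[OF assms st(1-3)] .
    have "z1 * (a t - a s) = z1 * ((b s - b t) * tan \<alpha>)"
      using st(4,5) z(2) by (simp add: algebra_simps)
    then have eq: "a t - a s = (b s - b t) * tan \<alpha>"
      using z1 by simp
    \<comment> \<open>The left side of \<open>eq\<close> and tan \<alpha> are positive, hence so is
      the remaining factor.\<close>
    then have b: "b t < b s"
      using less tan by (smt (verit) zero_less_mult_pos2)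
    then have "angle (s, t) = \<alpha>"
      using eq \<alpha> by (simp add: angle_def arctan_tan)
    moreover have "(s, t) \<in> crossing_pairs T b"
      using st b by (simp add: crossing_pairs_def)
    ultimately show "\<alpha> \<in> angle ` crossing_pairs T b"
      by force
  qed
  ultimately show ?thesis
    by (meson card_image_le card_mono finite_imageI le_trans)
qed

section \<open>Sorting permutations and their inversions\<close>

lemma sorting_perm_exists:
  fixes b :: "nat \<Rightarrow> real"
  assumes "inj_on b {1..T}"
  obtains \<pi> where "\<pi> permutes {1..T}" "strict_mono_on {1..T} (\<lambda>i. b (\<pi> i))"
proof -
  \<comment> \<open>The rank of \<open>b t\<close> among all values, continued by the identity
    outside \<open>{1..T}\<close>. Rank sends an index to its place in the sorted row, so the
    sorting permutation is \<open>inv r\<close>.\<close>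
  define r where "r t = (if t \<in> {1..T} then card {s \<in> {1..T}. b s \<le> b t} else t)" for t
  have mono: "r s < r t" if "s \<in> {1..T}" "t \<in> {1..T}" "b s < b t" for s t
  proof -
    have "{u \<in> {1..T}. b u \<le> b s} \<subset> {u \<in> {1..T}. b u \<le> b t}"
    proof
      show "{u \<in> {1..T}. b u \<le> b s} \<subseteq> {u \<in> {1..T}. b u \<le> b t}"
        using that(3) by auto
      show "{u \<in> {1..T}. b u \<le> b s} \<noteq> {u \<in> {1..T}. b u \<le> b t}"
        using that(2,3) by (metis (mono_tags, lifting) leD mem_Collect_eq order_refl)
    qed
    then show ?thesis
      using that(1,2) by (simp add: r_def psubset_card_mono)
  qed
  have inj: "inj_on r {1..T}"
  proof (rule inj_onI)
    fix s t assume st: "s \<in> {1..T}" "t \<in> {1..T}" "r s = r t"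
    then have "b s = b t"
      using mono[of s t] mono[of t s] by (metis less_irrefl linorder_less_linear)
    then show "s = t"
      using assms st by (simp add: inj_on_eq_iff)
  qed
  have "r t \<in> {1..T}" if t: "t \<in> {1..T}" for t
  proof -
    have "0 < card {s \<in> {1..T}. b s \<le> b t}"
      using t by (subst card_gt_0_iff) auto
    moreover have "card {s \<in> {1..T}. b s \<le> b t} \<le> card {1..T}"
      by (intro card_mono) auto
    ultimately show ?thesis
      using t by (simp add: r_def)
  qed
  then have "r ` {1..T} = {1..T}"
    using inj by (intro endo_inj_surj) auto
  then have perm: "r permutes {1..T}"
    using inj by (intro bij_imp_permutes) (auto simp: bij_betw_def r_def)
  have "strict_mono_on {1..T} (\<lambda>i. b (inv r i))"
  proof (rule strict_mono_onI)
    fix i j assume ij: "i \<in> {1..T}" "j \<in> {1..T}" "i < j"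
    have r: "r (inv r i) = i" "r (inv r j) = j"
      using perm by (simp_all add: permutes_inverses)
    have mem: "inv r i \<in> {1..T}" "inv r j \<in> {1..T}"
      using ij permutes_in_image[OF permutes_inv[OF perm]] by blast+
    then have "\<not> b (inv r j) < b (inv r i)"
      using mono[of "inv r j" "inv r i"] r ij by auto
    moreover have "b (inv r i) \<noteq> b (inv r j)"
      using inj_on_eq_iff[OF assms mem] r ij(3) by auto
    ultimately show "b (inv r i) < b (inv r j)"
      by simp
  qed
  with permutes_inv[OF perm] show ?thesis
    using that by blast
qed

text \<open>A descent of \<open>inv \<pi> \<circ> \<pi>'\<close> would be a pair of neighbouring
  places of \<open>\<pi>'\<close> whose \<open>b\<close>-values the two permutations order
  oppositely.\<close>

lemma sorting_perm_unique:
  fixes b :: "nat \<Rightarrow> real"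
  assumes "\<pi> permutes {1..T}" "strict_mono_on {1..T} (\<lambda>i. b (\<pi> i))"
    and "\<pi>' permutes {1..T}" "strict_mono_on {1..T} (\<lambda>i. b (\<pi>' i))"
  shows "\<pi>' = \<pi>"
proof -
  let ?f = "inv \<pi> \<circ> \<pi>'"
  have f: "?f permutes {1..T}"
    using assms by (intro permutes_compose permutes_inv)
  have inv: "\<pi> (?f i) = \<pi>' i" for i
    using assms(1) by (simp add: permutes_inverses)
  have "\<not> descent ?f k" for k
  proof
    assume d: "descent ?f k"
    then have k: "k \<in> {1..T}" "Suc k \<in> {1..T}"
      using exchange_permutes(1)[OF f d] by auto
    then have "?f k \<in> {1..T}" "?f (Suc k) \<in> {1..T}"
      using permutes_in_image[OF f] by blast+
    then have "b (\<pi> (?f (Suc k))) < b (\<pi> (?f k))"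
      using d strict_mono_onD[OF assms(2)] by blast
    moreover have "b (\<pi>' k) < b (\<pi>' (Suc k))"
      using k strict_mono_onD[OF assms(4)] by blast
    ultimately show False
      unfolding inv by simp
  qed
  then have "?f = id"
    using permutes_no_descent[OF f] by blast
  then show ?thesis
    using inv by (metis id_apply ext)
qed

lemma sorting_perm_properties:
  assumes "inj_on b {1..T}"
  shows "sorting_perm T b permutes {1..T}"
    and "strict_mono_on {1..T} (\<lambda>i. b (sorting_perm T b i))"
proof -
  have "\<exists>!\<pi>. \<pi> permutes {1..T} \<and> strict_mono_on {1..T} (\<lambda>i. b (\<pi> i))"
    using sorting_perm_exists[OF assms] sorting_perm_unique by metis
  then have "sorting_perm T b permutes {1..T}
      \<and> strict_mono_on {1..T} (\<lambda>i. b (sorting_perm T b i))"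
    unfolding sorting_perm_def by (rule theI')
  then show "sorting_perm T b permutes {1..T}"
    and "strict_mono_on {1..T} (\<lambda>i. b (sorting_perm T b i))"
    by blast+
qed

text \<open>The row of \<open>\<pi>\<close> lists the indices by increasing \<open>b\<close>. In a
  crossing pair (s, t) the larger index t has the smaller value, so it stands first, and the places
  of t and s form an inversion.\<close>

lemma card_crossing_pairs_le:
  assumes "\<pi> permutes {1..T}" "strict_mono_on {1..T} (\<lambda>i. b (\<pi> i))"
  shows "card (crossing_pairs T b) \<le> card (inversions \<pi>)"
proof -
  have "crossing_pairs T b \<subseteq> (\<lambda>(i, j). (\<pi> j, \<pi> i)) ` inversions \<pi>"
  proof clarify
    fix s t assume st: "(s, t) \<in> crossing_pairs T b"
    let ?i = "inv \<pi> t" and ?j = "inv \<pi> s"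
    have \<pi>: "\<pi> ?i = t" "\<pi> ?j = s"
      using assms(1) by (simp_all add: permutes_inverses)
    have mem: "?i \<in> {1..T}" "?j \<in> {1..T}"
      using st permutes_in_image[OF permutes_inv[OF assms(1)]] by (auto simp: crossing_pairs_def)
    have "\<not> ?j < ?i" "?i \<noteq> ?j"
      using strict_mono_onD[OF assms(2) mem(2,1)] \<pi> st by (auto simp: crossing_pairs_def)
    then have "(?i, ?j) \<in> inversions \<pi>"
      using \<pi> st by (auto simp: inversions_def crossing_pairs_def)
    then show "(s, t) \<in> (\<lambda>(i, j). (\<pi> j, \<pi> i)) ` inversions \<pi>"
      using \<pi> by force
  qed
  then show ?thesis
    using inversions_permutes(2)[OF assms(1)] by (rule surj_card_le[rotated])
qed

section \<open>Independence of the parameter and conclusion\<close>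

lemma ptilde_less_iff:
  assumes "\<rho> \<in> rho_range" "phat p0 p s > 0" "phat p0 p t > 0"
  shows "ptilde \<epsilon> p0 p \<rho> s < ptilde \<epsilon> p0 p \<rho> t \<longleftrightarrow> phat p0 p s < phat p0 p t"
proof (cases "\<rho> < 0")
  case True
  then have "phat p0 p s powr (-\<rho>) < phat p0 p t powr (-\<rho>) \<longleftrightarrow> phat p0 p s < phat p0 p t"
    using assms by (smt (verit) powr_less_mono2)
  then show ?thesis
    using True by (simp add: ptilde_def)
next
  case False
  then have "\<rho> > 0"
    using assms(1) by (auto simp: rho_range_def)
  \<comment> \<open>The negative exponent reverses the order; subtracting from the constant
    \<open>1 / \<epsilon> \<rho>\<close> reverses it back.\<close>
  then have "phat p0 p t powr (-\<rho>) < phat p0 p s powr (-\<rho>) \<longleftrightarrow> phat p0 p s < phat p0 p t"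
    using assms by (smt (verit) powr_less_mono2_neg)
  then show ?thesis
    using False by (simp add: ptilde_def)
qed

text \<open>Crossing angles, crossing pairs and inversions bound the length from above in turn, and
  \<open>card_inversions_word_perm\<close> bounds it from below, so equality holds.\<close>

lemma formal_word_reduced:
  assumes "strict_mono_on {1..T} a" "\<pi> permutes {1..T}" "strict_mono_on {1..T} (\<lambda>i. b (\<pi> i))"
    and "word_perm (formal_word T a b) = \<pi>"
  shows "reduced (formal_word T a b)"
proof -
  have "length (formal_word T a b) \<le> card (inversions \<pi>)"
    unfolding length_formal_word
    using card_crossing_angles_le[OF assms(1)] card_crossing_pairs_le[OF assms(2,3)]
    by (rule le_trans)
  then show ?thesis
    using card_inversions_word_perm[of "formal_word T a b"] assms(4) by (simp add: reduced_def)
qed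

theorem proposition6p2:
  fixes T :: nat
    and p0 p1 p2 :: "nat \<Rightarrow> real"
    and \<epsilon> :: "real \<Rightarrow> real"
    and \<rho> \<rho>1 \<rho>2 :: real
    and \<omega>1 \<omega>2 :: "nat list"
  assumes prices_pos: "\<And>t. t \<in> {1..T} \<Longrightarrow> p0 t > 0 \<and> p1 t > 0 \<and> p2 t > 0"
    and eps: "\<And>r. r > 0 \<Longrightarrow> admissible_eps T p0 p1 p2 r (\<epsilon> r)"
    and rho: "\<rho> \<in> rho_range"
    and numbering: "strict_mono_on {1..T} (ptilde \<epsilon> p0 p1 \<rho>)"
    and distinct2: "inj_on (ptilde \<epsilon> p0 p2 \<rho>) {1..T}"
    and rho1: "\<rho>1 \<in> rho_range"
    and rho2: "\<rho>2 \<in> rho_range"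
    and generic1: "generic_lines T (ptilde \<epsilon> p0 p1 \<rho>1) (ptilde \<epsilon> p0 p2 \<rho>1)"
    and generic2: "generic_lines T (ptilde \<epsilon> p0 p1 \<rho>2) (ptilde \<epsilon> p0 p2 \<rho>2)"
    and word1: "\<omega>1 = formal_word T (ptilde \<epsilon> p0 p1 \<rho>1) (ptilde \<epsilon> p0 p2 \<rho>1)"
    and word2: "\<omega>2 = formal_word T (ptilde \<epsilon> p0 p1 \<rho>2) (ptilde \<epsilon> p0 p2 \<rho>2)"
    and perm1: "word_perm \<omega>1 = sorting_perm T (ptilde \<epsilon> p0 p2 \<rho>)"
    and perm2: "word_perm \<omega>2 = sorting_perm T (ptilde \<epsilon> p0 p2 \<rho>)"
  shows "transformable T \<omega>1 \<omega>2"
proof -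
  define \<pi> where "\<pi> = sorting_perm T (ptilde \<epsilon> p0 p2 \<rho>)"
  have \<pi>: "\<pi> permutes {1..T}" "strict_mono_on {1..T} (\<lambda>i. ptilde \<epsilon> p0 p2 \<rho> (\<pi> i))"
    unfolding \<pi>_def by (rule sorting_perm_properties[OF distinct2])+
  have pos: "phat p0 p1 t > 0" "phat p0 p2 t > 0" if "t \<in> {1..T}" for t
    using prices_pos[OF that] by (simp_all add: phat_def)
  have \<pi>_mem: "\<pi> i \<in> {1..T}" if "i \<in> {1..T}" for i
    using permutes_in_image[OF \<pi>(1)] that by blast
  \<comment> \<open>At every parameter the coefficients are ordered like the normalized prices.
    Hence the numbering, and in \<open>mono2\<close> the sorting permutation, fixed at
    \<open>\<rho>\<close> serve for \<open>\<rho>1\<close> and \<open>\<rho>2\<close> too.\<close>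
  have mono1: "strict_mono_on {1..T} (ptilde \<epsilon> p0 p1 r)" if "r \<in> rho_range" for r
    using numbering unfolding strict_mono_on_def
    by (metis ptilde_less_iff pos(1) rho that)
  have mono2: "strict_mono_on {1..T} (\<lambda>i. ptilde \<epsilon> p0 p2 r (\<pi> i))" if "r \<in> rho_range" for r
    using \<pi>(2) unfolding strict_mono_on_def
    by (metis ptilde_less_iff pos(2) rho that \<pi>_mem)
  have "reduced \<omega>1" "reduced \<omega>2"
    unfolding word1 word2
    using perm1 perm2 rho1 rho2 word1 word2
    by (auto intro!: formal_word_reduced[where \<pi> = \<pi>] mono1 mono2 \<pi> simp: \<pi>_def)
  then show ?thesis
    using perm1 perm2 \<pi>(1) by (intro reduced_words_transformable) (simp_all add: \<pi>_def)
qed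

end
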